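(* Let $G=(V,E)$ be a finite connected graph with $\mathrm{Ric}(G)\ge K$ for some $K\in\mathbb R$, and let $\lambda>0$ be the minimal nonzero eigenvalue of $-\Delta$. Then for every subset $A\subset V$, $$|\partial A|\ge \frac12\min\Big\{\sqrt\lambda,\frac{\lambda}{\sqrt{2|K|}}\Big\}\,|A|\Big(1-\frac{|A|}{|V|}\Big),$$ where $\partial A$ is the set of edges connecting $A$ to $V\setminus A$ (and $\lambda/\sqrt{2|K|}$ is interpreted as $+\infty$ when $K=0$).
   Context: Let $G=(V,E)$ be an undirected simple graph with no isolated vertices; $y\sim x$ means adjacency. For $f,g:V\to\mathbb R$ define $\Delta f(x)=\sum_{y\sim x}(f(y)-f(x))$, $\Gamma(f,g)(x)=\frac12\sum_{y\sim x}(f(x)-f(y))(g(x)-g(y))$, $\Gamma(f)=\Gamma(f,f)$, $\Gamma_2(f)=\frac12\Delta\Gamma(f)-\Gamma(f,\Delta f)$. "$\mathrm{Ric}(G)\ge K$" means $\Gamma_2(f)(x)\ge K\,\Gamma(f)(x)$ for all $f:V\to\mathbb R$ and $x\in V$. *)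

theory Defs
  imports
    Complex_Main
    "HOL-Library.Extended_Real"
    "Graph_Theory.Graph_Theory"
begin

text \<open>
  An undirected simple graph is a symmetric digraph without loops or parallel arcs (locale
  \<open>graph\<close>), each edge being represented by two opposite arcs.  A function
  \<open>V \<rightarrow> \<real>\<close> is a total function on the vertex type; since all neighbours of a vertex lie in
  \<open>verts G\<close>, its values outside \<open>verts G\<close> never matter.
\<close>

definition neighbors :: "('a, 'b) pre_digraph \<Rightarrow> 'a \<Rightarrow> 'a set" where
  "neighbors G x = {y. x \<rightarrow>\<^bsub>G\<^esub> y}"

definition laplacian :: "('a, 'b) pre_digraph \<Rightarrow> ('a \<Rightarrow> real) \<Rightarrow> 'a \<Rightarrow> real" where
  "laplacian G f x = (\<Sum>y\<in>neighbors G x. f y - f x)"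

definition carre_du_champ ::
  "('a, 'b) pre_digraph \<Rightarrow> ('a \<Rightarrow> real) \<Rightarrow> ('a \<Rightarrow> real) \<Rightarrow> 'a \<Rightarrow> real" where
  "carre_du_champ G f g x = (1 / 2) * (\<Sum>y\<in>neighbors G x. (f x - f y) * (g x - g y))"

definition carre_du_champ2 :: "('a, 'b) pre_digraph \<Rightarrow> ('a \<Rightarrow> real) \<Rightarrow> 'a \<Rightarrow> real" where
  "carre_du_champ2 G f x =
     (1 / 2) * laplacian G (carre_du_champ G f f) x - carre_du_champ G f (laplacian G f) x"

definition ric_ge :: "('a, 'b) pre_digraph \<Rightarrow> real \<Rightarrow> bool" where
  "ric_ge G K \<longleftrightarrow>
     (\<forall>f. \<forall>x\<in>verts G. carre_du_champ2 G f x \<ge> K * carre_du_champ G f f x)"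

definition neg_laplacian_eigenvalue :: "('a, 'b) pre_digraph \<Rightarrow> real \<Rightarrow> bool" where
  "neg_laplacian_eigenvalue G \<mu> \<longleftrightarrow>
     (\<exists>f. (\<exists>x\<in>verts G. f x \<noteq> 0) \<and> (\<forall>x\<in>verts G. - laplacian G f x = \<mu> * f x))"

definition min_nonzero_eigenvalue :: "('a, 'b) pre_digraph \<Rightarrow> real \<Rightarrow> bool" where
  "min_nonzero_eigenvalue G l \<longleftrightarrow>
     neg_laplacian_eigenvalue G l \<and> l \<noteq> 0 \<and>
     (\<forall>\<mu>. neg_laplacian_eigenvalue G \<mu> \<and> \<mu> \<noteq> 0 \<longrightarrow> l \<le> \<mu>)"

text \<open>Undirected edges are two-element sets, so that each edge is counted once and not as two
  arcs.\<close>

definition edge_boundary :: "('a, 'b) pre_digraph \<Rightarrow> 'a set \<Rightarrow> 'a set set" where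
  "edge_boundary G A = {{u, v} | u v. u \<in> A \<and> v \<in> verts G - A \<and> u \<rightarrow>\<^bsub>G\<^esub> v}"

end

theory Submission
  imports Defs "HOL-Analysis.Analysis"
begin

text \<open>
  Let \<open>P\<^sub>t = exp (t\<Delta>)\<close> and \<open>k = max |K| (\<lambda>/2)\<close>, so that the curvature is at least \<open>-k\<close>. Differentiating
  \<open>s \<mapsto> P\<^sub>s ((P\<^sub>t\<^sub>-\<^sub>s f)\<^sup>2)\<close> twice gives the reverse Poincare inequality
  \<open>(1 - exp (-2kt)) / k \<cdot> \<Gamma> (P\<^sub>t f) \<le> P\<^sub>t (f\<^sup>2) - (P\<^sub>t f)\<^sup>2\<close>. For \<open>f = 1\<^sub>A\<close> the right-hand side is at
  most \<open>1/4\<close>, so every edge difference of \<open>P\<^sub>s 1\<^sub>A\<close> is \<open>O (s\<^sup>-\<^sup>1\<^sup>/\<^sup>2)\<close> for \<open>s \<le> 1/(2k)\<close>. Since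
  \<open>\<langle>1\<^sub>A, P\<^sub>s 1\<^sub>A\<rangle>\<close> decreases at the rate given by the sum of these differences over \<open>\<partial>A\<close>, it drops by
  \<open>O (|\<partial>A| \<surd>t)\<close> up to time \<open>t\<close>; the spectral gap forces a drop of at least
  \<open>(1 - exp (-\<lambda>t)) |A| (1 - |A|/|V|)\<close>. Take \<open>t = 1/(2k)\<close>.

  The constant \<open>c = 63/100\<close> is a lower bound for \<open>1 - 1/e\<close>, whence \<open>1 - exp (-x) \<ge> c x\<close> on \<open>[0,1]\<close>; the
  factor \<open>1/2\<close> of the theorem comes out because \<open>c\<^sup>3 \<ge> 1/4\<close>.
\<close>

section \<open>Elementary real inequalities\<close>

lemma one_minus_exp_ge:
  fixes x :: real
  assumes "0 \<le> x" "x \<le> 1"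
  shows "63 / 100 * x \<le> 1 - exp (- x)"
proof -
  \<comment> \<open>Five Taylor terms suffice: they sum to \<open>65/24\<close>, and
    \<open>1 - 24/65 > 63/100\<close>.\<close>
  have "(\<Sum>m<5. 1 ^ m / fact m) \<le> exp (1 :: real)"
    using Maclaurin_exp_le[of 1 5] by auto
  then have "65 / 24 \<le> exp (1 :: real)"
    by (simp add: eval_nat_numeral fact_numeral)
  then have "exp (- 1 :: real) \<le> 24 / 65"
    by (simp add: exp_minus field_simps)
  \<comment> \<open>On \<open>[-1,0]\<close> a convex function lies below its chord, so only the
    value at \<open>-1\<close> needs an estimate.\<close>
  have "convex_on UNIV (exp :: real \<Rightarrow> real)"
    by (rule exp_convex)
  then have "exp ((1 - x) *\<^sub>R 0 + x *\<^sub>R (- 1)) \<le> (1 - x) * exp 0 + x * exp (- 1 :: real)"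
    using assms by (intro convex_onD) auto
  also have "\<dots> \<le> 1 - x + x * (24 / 65)"
    using mult_left_mono[OF \<open>exp (- 1) \<le> 24 / 65\<close> assms(1)] by simp
  finally show ?thesis
    using assms by simp
qed

text \<open>Near \<open>e = 0\<close> the linear term dominates unless \<open>b\<close> vanishes.
  This serves as the first-order condition at a minimiser of the Rayleigh quotient.\<close>

lemma linear_coeff_zero_of_quadratic_nonneg:
  fixes b q :: real
  assumes "\<And>e. 0 \<le> 2 * e * b + e\<^sup>2 * q"
  shows "b = 0"
proof (rule ccontr)
  assume "b \<noteq> 0"
  \<comment> \<open>The minimiser of the parabola with \<open>q\<close> enlarged to
    \<open>\<bar>q\<bar> + 1\<close>, a leading coefficient that is positive whatever the sign of
    \<open>q\<close>.\<close>
  define e where "e = - b / (\<bar>q\<bar> + 1)"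
  have "2 * e * b + e\<^sup>2 * q \<le> 2 * e * b + e\<^sup>2 * (\<bar>q\<bar> + 1)"
    by (intro add_left_mono mult_left_mono) auto
  also have "\<dots> = - b\<^sup>2 / (\<bar>q\<bar> + 1)"
    by (simp add: e_def power2_eq_square divide_simps)
  also have "\<dots> < 0"
    using \<open>b \<noteq> 0\<close> by (simp add: divide_neg_pos add_nonneg_pos)
  finally show False
    using assms[of e] by simp
qed

section \<open>Green's formula on a graph\<close>

context Digraph.graph
begin

lemma neighbors_subset: "neighbors G x \<subseteq> verts G"
  unfolding neighbors_def by (auto elim!: reachableE)

lemma finite_neighbors [simp]: "finite (neighbors G x)"
  using neighbors_subset finite_verts finite_subset by blast

lemma neighbors_sym: "y \<in> neighbors G x \<longleftrightarrow> x \<in> neighbors G y"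
  unfolding neighbors_def using arcs_ends_symmetric[OF sym_arcs] by blast

lemma sum_neighbors_eq_sum_verts:
  "(\<Sum>y\<in>neighbors G x. F y) = (\<Sum>y\<in>verts G. if y \<in> neighbors G x then F y else 0)"
  using neighbors_subset by (intro sum.mono_neutral_cong_left) auto

text \<open>Adjacency is symmetric. Extending the inner sum by zeros to all vertices makes the index
  sets independent, so the order of summation can be exchanged.\<close>

lemma sum_adjacent_swap:
  "(\<Sum>x\<in>verts G. \<Sum>y\<in>neighbors G x. F x y) = (\<Sum>x\<in>verts G. \<Sum>y\<in>neighbors G x. F y x)"
proof -
  have "(\<Sum>x\<in>verts G. \<Sum>y\<in>neighbors G x. F x y)
      = (\<Sum>x\<in>verts G. \<Sum>y\<in>verts G. if y \<in> neighbors G x then F x y else 0)"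
    by (subst sum_neighbors_eq_sum_verts) simp
  also have "\<dots> = (\<Sum>y\<in>verts G. \<Sum>x\<in>verts G. if x \<in> neighbors G y then F x y else 0)"
    by (subst sum.swap) (simp add: neighbors_sym)
  also have "\<dots> = (\<Sum>x\<in>verts G. \<Sum>y\<in>neighbors G x. F y x)"
    by (subst sum_neighbors_eq_sum_verts) simp
  finally show ?thesis .
qed

text \<open>Summation by parts: pairing the two orientations of each edge turns the weight
  \<open>g x\<close> into half of \<open>g x - g y\<close>. The right-hand sum is the Dirichlet
  form.\<close>

lemma sum_mult_laplacian:
  "(\<Sum>x\<in>verts G. g x * laplacian G f x) = - (\<Sum>x\<in>verts G. carre_du_champ G f g x)"
proof -
  let ?S = "\<lambda>F. \<Sum>x\<in>verts G. \<Sum>y\<in>neighbors G x. (F x y :: real)"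
  have "?S (\<lambda>x y. (f x - f y) * (g x - g y))
      = ?S (\<lambda>x y. (f x - f y) * g x) - ?S (\<lambda>x y. (f x - f y) * g y)"
    by (simp add: sum_subtractf right_diff_distrib)
  also have "?S (\<lambda>x y. (f x - f y) * g y) = ?S (\<lambda>x y. (f y - f x) * g x)"
    by (rule sum_adjacent_swap)
  also have "?S (\<lambda>x y. (f x - f y) * g x) = - ?S (\<lambda>x y. (f y - f x) * g x)"
    by (simp flip: sum_negf add: algebra_simps)
  finally have "?S (\<lambda>x y. (f x - f y) * (g x - g y)) = - 2 * ?S (\<lambda>x y. (f y - f x) * g x)"
    by simp
  then show ?thesis
    unfolding laplacian_def carre_du_champ_def sum_distrib_left[symmetric]
    by (simp add: sum_distrib_left sum_negf mult.commute flip: sum_divide_distrib)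
qed

lemma carre_du_champ_commute: "carre_du_champ G f g x = carre_du_champ G g f x"
  by (simp add: carre_du_champ_def mult.commute)

lemma laplacian_self_adjoint:
  "(\<Sum>x\<in>verts G. g x * laplacian G f x) = (\<Sum>x\<in>verts G. laplacian G g x * f x)"
  by (simp add: sum_mult_laplacian carre_du_champ_commute mult.commute[of "laplacian G _ _"])

lemma sum_laplacian: "(\<Sum>x\<in>verts G. laplacian G f x) = 0"
  using sum_mult_laplacian[of "\<lambda>_. 1" f] by (simp add: carre_du_champ_def)

lemma carre_du_champ_nonneg: "0 \<le> carre_du_champ G f f x"
  by (simp add: carre_du_champ_def sum_nonneg)

text \<open>Termwise this is \<open>b\<^sup>2 - a\<^sup>2 = 2 a (b - a) + (b - a)\<^sup>2\<close>.
  The excess \<open>2 \<Gamma>\<close> over the product rule is where the gradient in the reverse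
  Poincare inequality comes from.\<close>

lemma laplacian_square:
  "laplacian G (\<lambda>y. (f y)\<^sup>2) x = 2 * f x * laplacian G f x + 2 * carre_du_champ G f f x"
  by (simp add: laplacian_def carre_du_champ_def sum_distrib_left flip: sum.distrib)
    (rule sum.cong; simp add: power2_eq_square algebra_simps)

subsection \<open>The heat semigroup\<close>

text \<open>The matrix of the Laplacian plus \<open>card (verts G)\<close> times the identity. The
  shift is at least every degree, so the diagonal is nonnegative too.\<close>

definition jump_matrix :: "'a \<Rightarrow> 'a \<Rightarrow> real" where
  "jump_matrix x y = (if y \<in> neighbors G x then 1 else 0)
     + (if x = y then real (card (verts G)) - real (card (neighbors G x)) else 0)"

lemma jump_matrix_nonneg: "0 \<le> jump_matrix x y"
  using card_mono[OF finite_verts neighbors_subset, of x] by (auto simp: jump_matrix_def)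

lemma jump_matrix_sym: "jump_matrix x y = jump_matrix y x"
  by (auto simp: jump_matrix_def neighbors_sym)

lemma sum_jump_matrix:
  assumes "x \<in> verts G"
  shows "(\<Sum>z\<in>verts G. jump_matrix x z * f z) = laplacian G f x + real (card (verts G)) * f x"
proof -
  have "(\<Sum>z\<in>verts G. jump_matrix x z * f z)
     = (\<Sum>z\<in>verts G. if z \<in> neighbors G x then f z else 0)
       + (\<Sum>z\<in>verts G. if x = z then (real (card (verts G)) - real (card (neighbors G x))) * f z else 0)"
    unfolding sum.distrib[symmetric] by (rule sum.cong) (auto simp: jump_matrix_def algebra_simps)
  also have "\<dots> = (\<Sum>z\<in>neighbors G x. f z)
       + (real (card (verts G)) - real (card (neighbors G x))) * f x"
    using assms by (simp flip: sum_neighbors_eq_sum_verts)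
  also have "\<dots> = laplacian G f x + real (card (verts G)) * f x"
    by (simp add: laplacian_def sum_subtractf algebra_simps)
  finally show ?thesis .
qed

fun jump_power :: "nat \<Rightarrow> 'a \<Rightarrow> 'a \<Rightarrow> real" where
  "jump_power 0 x y = (if x = y then 1 else 0)"
| "jump_power (Suc n) x y = (\<Sum>z\<in>verts G. jump_matrix x z * jump_power n z y)"

lemma jump_power_nonneg: "0 \<le> jump_power n x y"
  by (induction n arbitrary: x) (auto intro!: sum_nonneg mult_nonneg_nonneg jump_matrix_nonneg)

text \<open>A matrix commutes with its powers. This form lets the time derivative of the kernel act
  on the second variable.\<close>

lemma jump_power_Suc_right:
  assumes "x \<in> verts G" "y \<in> verts G"
  shows "jump_power (Suc n) x y = (\<Sum>z\<in>verts G. jump_power n x z * jump_matrix z y)"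
  using assms
proof (induction n arbitrary: x)
  case 0
  have "(\<Sum>z\<in>verts G. jump_matrix x z * (if z = y then 1 else 0)) = jump_matrix x y"
    using 0 by (simp add: if_distrib cong: if_cong)
  moreover have "(\<Sum>z\<in>verts G. (if x = z then 1 else 0) * jump_matrix z y) = jump_matrix x y"
    using 0 by (simp add: if_distrib[of "\<lambda>u. u * _"] cong: if_cong)
  ultimately show ?case by simp
next
  case (Suc n)
  have "jump_power (Suc (Suc n)) x y
      = (\<Sum>z\<in>verts G. jump_matrix x z * (\<Sum>w\<in>verts G. jump_power n z w * jump_matrix w y))"
    unfolding jump_power.simps(2)[of "Suc n"] using Suc by (intro sum.cong) auto
  also have "\<dots> = (\<Sum>w\<in>verts G. \<Sum>z\<in>verts G. jump_matrix x z * (jump_power n z w * jump_matrix w y))"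
    unfolding sum_distrib_left by (rule sum.swap)
  also have "\<dots> = (\<Sum>w\<in>verts G. jump_power (Suc n) x w * jump_matrix w y)"
    by (simp add: sum_distrib_right mult.assoc)
  finally show ?case .
qed

text \<open>The Laplacian kills constants, so every row of \<open>jump_matrix\<close> sums to the
  shift. With nonnegativity this bounds each entry and makes the exponential series
  converge.\<close>

lemma sum_jump_power:
  assumes "x \<in> verts G"
  shows "(\<Sum>y\<in>verts G. jump_power n x y) = real (card (verts G)) ^ n"
  using assms
proof (induction n arbitrary: x)
  case (Suc n)
  have "(\<Sum>y\<in>verts G. jump_power (Suc n) x y)
      = (\<Sum>z\<in>verts G. jump_matrix x z * (\<Sum>y\<in>verts G. jump_power n z y))"
    unfolding jump_power.simps sum_distrib_left by (rule sum.swap)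
  also have "\<dots> = (\<Sum>z\<in>verts G. jump_matrix x z * real (card (verts G)) ^ n)"
    using Suc by simp
  also have "\<dots> = real (card (verts G)) ^ Suc n"
    by (subst sum_jump_matrix[OF Suc.prems]) (simp add: laplacian_def)
  finally show ?case .
qed auto

lemma jump_power_le:
  assumes "x \<in> verts G" "y \<in> verts G"
  shows "jump_power n x y \<le> real (card (verts G)) ^ n"
  using member_le_sum[of y "verts G" "jump_power n x"] assms
  by (simp add: jump_power_nonneg sum_jump_power)

lemma summable_jump_power:
  assumes "x \<in> verts G" "y \<in> verts G"
  shows "summable (\<lambda>n. jump_power n x y / fact n * t ^ n)"
proof (rule summable_comparison_test')
  show "summable (\<lambda>n. inverse (fact n) * (real (card (verts G)) * \<bar>t\<bar>) ^ n)"
    by (rule summable_exp)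
  show "norm (jump_power n x y / fact n * t ^ n)
      \<le> inverse (fact n) * (real (card (verts G)) * \<bar>t\<bar>) ^ n" for n
    using jump_power_le[OF assms, of n] jump_power_nonneg[of n x y]
    by (simp add: abs_mult power_abs power_mult_distrib divide_inverse mult_right_mono mult.assoc mult.left_commute)
qed

text \<open>The matrix exponential, written entrywise as a real power series in \<open>t\<close> so
  that it can be differentiated term by term.\<close>

definition jump_exp :: "real \<Rightarrow> 'a \<Rightarrow> 'a \<Rightarrow> real" where
  "jump_exp t x y = (\<Sum>n. jump_power n x y / fact n * t ^ n)"

lemma has_derivative_jump_exp:
  assumes "x \<in> verts G" "y \<in> verts G"
  shows "((\<lambda>t. jump_exp t x y) has_real_derivative
           (\<Sum>n. jump_power (Suc n) x y / fact n * t ^ n)) (at t)"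
proof -
  have "diffs (\<lambda>n. jump_power n x y / fact n) = (\<lambda>n. jump_power (Suc n) x y / fact n)"
    by (rule ext) (simp add: diffs_def field_simps del: jump_power.simps of_nat_Suc)
  then show ?thesis
    using termdiffs_strong_converges_everywhere[OF summable_jump_power[OF assms], of t]
    unfolding jump_exp_def by (simp del: jump_power.simps)
qed

lemma suminf_jump_power_Suc_left:
  assumes "x \<in> verts G" "y \<in> verts G"
  shows "(\<Sum>n. jump_power (Suc n) x y / fact n * t ^ n)
       = (\<Sum>z\<in>verts G. jump_matrix x z * jump_exp t z y)"
proof -
  have "(\<Sum>n. jump_power (Suc n) x y / fact n * t ^ n)
      = (\<Sum>n. \<Sum>z\<in>verts G. jump_matrix x z * (jump_power n z y / fact n * t ^ n))"
    by (simp add: sum_distrib_right sum_divide_distrib mult.assoc)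
  also have "\<dots> = (\<Sum>z\<in>verts G. \<Sum>n. jump_matrix x z * (jump_power n z y / fact n * t ^ n))"
    using assms by (intro suminf_sum summable_mult summable_jump_power) auto
  also have "\<dots> = (\<Sum>z\<in>verts G. jump_matrix x z * jump_exp t z y)"
    unfolding jump_exp_def
    using assms by (intro sum.cong suminf_mult summable_jump_power) auto
  finally show ?thesis .
qed

lemma suminf_jump_power_Suc_right:
  assumes "x \<in> verts G" "y \<in> verts G"
  shows "(\<Sum>n. jump_power (Suc n) x y / fact n * t ^ n)
       = (\<Sum>z\<in>verts G. jump_matrix y z * jump_exp t x z)"
proof -
  have "(\<Sum>n. jump_power (Suc n) x y / fact n * t ^ n)
      = (\<Sum>n. \<Sum>z\<in>verts G. jump_matrix y z * (jump_power n x z / fact n * t ^ n))"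
    unfolding jump_power_Suc_right[OF assms]
    by (simp add: sum_distrib_left sum_divide_distrib mult_ac jump_matrix_sym[of y])
  also have "\<dots> = (\<Sum>z\<in>verts G. \<Sum>n. jump_matrix y z * (jump_power n x z / fact n * t ^ n))"
    using assms by (intro suminf_sum summable_mult summable_jump_power) auto
  also have "\<dots> = (\<Sum>z\<in>verts G. jump_matrix y z * jump_exp t x z)"
    unfolding jump_exp_def
    using assms by (intro sum.cong suminf_mult summable_jump_power) auto
  finally show ?thesis .
qed

text \<open>Writing \<open>\<Delta> = M - c\<close> with an entrywise nonnegative \<open>M\<close> (here \<open>c = |V|\<close>), the kernel
  \<open>exp (t\<Delta>) = exp (-ct) exp (tM)\<close> is visibly nonnegative for \<open>t \<ge> 0\<close>.\<close>

definition heat_kernel :: "real \<Rightarrow> 'a \<Rightarrow> 'a \<Rightarrow> real" where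
  "heat_kernel t x y = exp (- (real (card (verts G)) * t)) * jump_exp t x y"

lemma heat_kernel_nonneg:
  assumes "x \<in> verts G" "y \<in> verts G" "0 \<le> t"
  shows "0 \<le> heat_kernel t x y"
  unfolding heat_kernel_def jump_exp_def using assms
  by (intro mult_nonneg_nonneg suminf_nonneg summable_jump_power divide_nonneg_nonneg)
    (auto simp: jump_power_nonneg)

lemma heat_kernel_0: "heat_kernel 0 x y = (if x = y then 1 else 0)"
  using powser_zero[of "\<lambda>n. jump_power n x y / fact n"]
  by (simp add: heat_kernel_def jump_exp_def)

text \<open>Kolmogorov's backward equation. Differentiating the exponential prefactor contributes
  minus the shift, which cancels the one built into \<open>jump_matrix\<close>.\<close>

lemma heat_kernel_backward:
  assumes "x \<in> verts G" "y \<in> verts G"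
  shows "((\<lambda>t. heat_kernel t x y) has_real_derivative laplacian G (\<lambda>z. heat_kernel t z y) x) (at t)"
proof -
  let ?c = "real (card (verts G))"
  have "((\<lambda>t. heat_kernel t x y) has_real_derivative
      (- ?c * heat_kernel t x y + (\<Sum>z\<in>verts G. jump_matrix x z * heat_kernel t z y))) (at t)"
    unfolding heat_kernel_def
    by (rule derivative_eq_intros refl
          has_derivative_jump_exp[OF assms, unfolded suminf_jump_power_Suc_left[OF assms]])+
      (simp add: sum_distrib_left mult_ac)
  then show ?thesis
    by (simp add: sum_jump_matrix[OF assms(1)])
qed

text \<open>The same cancellation with the matrix factor split off on the other side, so that the
  Laplacian acts on the variable that \<open>heat\<close> sums over.\<close>

lemma heat_kernel_forward:
  assumes "x \<in> verts G" "y \<in> verts G"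
  shows "((\<lambda>t. heat_kernel t x y) has_real_derivative laplacian G (heat_kernel t x) y) (at t)"
proof -
  let ?c = "real (card (verts G))"
  have "((\<lambda>t. heat_kernel t x y) has_real_derivative
      (- ?c * heat_kernel t x y + (\<Sum>z\<in>verts G. jump_matrix y z * heat_kernel t x z))) (at t)"
    unfolding heat_kernel_def
    by (rule derivative_eq_intros refl
          has_derivative_jump_exp[OF assms, unfolded suminf_jump_power_Suc_right[OF assms]])+
      (simp add: sum_distrib_left mult_ac)
  then show ?thesis
    by (simp add: sum_jump_matrix[OF assms(2)])
qed

section \<open>The heat semigroup acting on functions\<close>

definition heat :: "real \<Rightarrow> ('a \<Rightarrow> real) \<Rightarrow> 'a \<Rightarrow> real" where
  "heat t f x = (\<Sum>y\<in>verts G. heat_kernel t x y * f y)"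

lemma heat_0: "x \<in> verts G \<Longrightarrow> heat 0 f x = f x"
  by (simp add: heat_def heat_kernel_0 if_distrib[of "\<lambda>u. u * _"] cong: if_cong)

lemma heat_mono:
  assumes "x \<in> verts G" "0 \<le> t" "\<And>y. y \<in> verts G \<Longrightarrow> f y \<le> g y"
  shows "heat t f x \<le> heat t g x"
  unfolding heat_def using assms by (intro sum_mono mult_left_mono heat_kernel_nonneg) auto

lemma heat_cmult: "heat t (\<lambda>y. a * f y) x = a * heat t f x"
  by (simp add: heat_def sum_distrib_left mult_ac)

lemma has_derivative_heat:
  assumes "x \<in> verts G"
  shows "((\<lambda>t. heat t f x) has_real_derivative laplacian G (heat t f) x) (at t)"
proof -
  have "((\<lambda>t. heat t f x) has_real_derivative
      (\<Sum>y\<in>verts G. laplacian G (\<lambda>z. heat_kernel t z y) x * f y)) (at t)"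
    unfolding heat_def using assms
    by (intro DERIV_sum DERIV_cmult_right heat_kernel_backward)
  also have "(\<Sum>y\<in>verts G. laplacian G (\<lambda>z. heat_kernel t z y) x * f y) = laplacian G (heat t f) x"
    by (simp add: laplacian_def heat_def sum_distrib_right left_diff_distrib flip: sum_subtractf)
      (rule sum.swap)
  finally show ?thesis .
qed

text \<open>The forward equation puts the Laplacian on the kernel, and self-adjointness moves it
  onto \<open>h s\<close>. Both interpolation arguments along the semigroup rest on this
  rule.\<close>

lemma has_derivative_heat_time_dependent:
  assumes "x \<in> verts G"
    and h: "\<And>y. y \<in> verts G \<Longrightarrow> ((\<lambda>s. h s y) has_real_derivative h' y) (at s)"
  shows "((\<lambda>s. heat s (h s) x) has_real_derivative
           heat s (\<lambda>y. laplacian G (h s) y + h' y) x) (at s)"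
proof -
  have "((\<lambda>s. heat s (h s) x) has_real_derivative
      (\<Sum>y\<in>verts G. laplacian G (heat_kernel s x) y * h s y + h' y * heat_kernel s x y)) (at s)"
    unfolding heat_def using assms
    by (intro DERIV_sum DERIV_mult heat_kernel_forward)
  also have "(\<Sum>y\<in>verts G. laplacian G (heat_kernel s x) y * h s y + h' y * heat_kernel s x y)
      = heat s (\<lambda>y. laplacian G (h s) y + h' y) x"
    by (simp add: heat_def sum.distrib distrib_left mult.commute[of "h' _"]
        flip: laplacian_self_adjoint[of "heat_kernel s x" "h s"])
  finally show ?thesis .
qed

lemma heat_const:
  assumes "x \<in> verts G"
  shows "heat t (\<lambda>_. a) x = a"
proof -
  have "((\<lambda>t. heat t (\<lambda>_. a) x) has_real_derivative 0) (at s)" for s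
    using has_derivative_heat_time_dependent[OF assms, of "\<lambda>_ _. a" "\<lambda>_. 0" s]
    by (simp add: laplacian_def) (simp add: heat_def)
  then have "heat t (\<lambda>_. a) x = heat 0 (\<lambda>_. a) x"
    by (intro DERIV_isconst_all) auto
  then show ?thesis using assms by (simp add: heat_0)
qed

text \<open>Conservation of mass: the time derivative is the sum of a Laplacian over all vertices,
  which is zero.\<close>

lemma sum_heat: "(\<Sum>x\<in>verts G. heat t f x) = (\<Sum>x\<in>verts G. f x)"
proof -
  have "((\<lambda>t. \<Sum>x\<in>verts G. heat t f x) has_real_derivative
      (\<Sum>x\<in>verts G. laplacian G (heat s f) x)) (at s)" for s
    by (intro DERIV_sum has_derivative_heat)
  then have "(\<Sum>x\<in>verts G. heat t f x) = (\<Sum>x\<in>verts G. heat 0 f x)"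
    by (intro DERIV_isconst_all) (auto simp: sum_laplacian)
  then show ?thesis by (simp add: heat_0)
qed


subsection \<open>Gradient bounds\<close>

lemma has_derivative_carre_du_champ:
  assumes "x \<in> verts G"
    and u: "\<And>y. y \<in> verts G \<Longrightarrow> ((\<lambda>s. u s y) has_real_derivative u' y) (at s)"
  shows "((\<lambda>s. carre_du_champ G (u s) (u s) x) has_real_derivative
           2 * carre_du_champ G (u s) u' x) (at s)"
proof -
  have nb: "y \<in> neighbors G x \<Longrightarrow> y \<in> verts G" for y
    using neighbors_subset by auto
  have "((\<lambda>s. carre_du_champ G (u s) (u s) x) has_real_derivative
      1 / 2 * (\<Sum>y\<in>neighbors G x. (u' x - u' y) * (u s x - u s y) + (u' x - u' y) * (u s x - u s y))) (at s)"
    unfolding carre_du_champ_def using nb assms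
    by (intro DERIV_cmult DERIV_sum DERIV_mult DERIV_diff) auto
  then show ?thesis
    by (simp add: carre_du_champ_def mult.commute flip: sum_distrib_left)
qed

lemma has_derivative_heat_reversed:
  assumes "x \<in> verts G"
  shows "((\<lambda>s. heat (t - s) f x) has_real_derivative - laplacian G (heat (t - s) f) x) (at s)"
proof -
  have "((\<lambda>s. t - s) has_real_derivative - 1) (at s)"
    by (auto intro!: derivative_eq_intros)
  from DERIV_chain2[OF has_derivative_heat[OF assms] this, of f] show ?thesis
    by simp
qed

text \<open>With \<open>\<Phi> s = P\<^sub>s (\<Gamma> (P\<^sub>t\<^sub>-\<^sub>s f))\<close> one has \<open>\<Phi>' = 2 P\<^sub>s (\<Gamma>\<^sub>2 (P\<^sub>t\<^sub>-\<^sub>s f)) \<ge> -2k \<Phi>\<close>.\<close>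

lemma heat_carre_du_champ_lower_bound:
  assumes ric: "ric_ge G (- k)" and x: "x \<in> verts G" and s: "0 \<le> s"
  shows "exp (- 2 * k * s) * carre_du_champ G (heat t f) (heat t f) x
       \<le> heat s (carre_du_champ G (heat (t - s) f) (heat (t - s) f)) x"
proof -
  define u where "u = (\<lambda>s. heat (t - s) f)"
  define \<Phi> where "\<Phi> = (\<lambda>s. heat s (carre_du_champ G (u s) (u s)) x)"
  have u': "((\<lambda>s. u s y) has_real_derivative - laplacian G (u s) y) (at s)"
    if "y \<in> verts G" for y s
    unfolding u_def by (rule has_derivative_heat_reversed[OF that])
  \<comment> \<open>The reversed flow satisfies \<open>u' = - \<Delta> u\<close>, so the two
    contributions to the derivative of \<open>\<Phi>\<close> combine to exactly
    \<open>2 \<Gamma>\<^sub>2\<close>.\<close>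
  have gamma2: "laplacian G (carre_du_champ G (u s) (u s)) y
      + 2 * carre_du_champ G (u s) (\<lambda>y. - laplacian G (u s) y) y = 2 * carre_du_champ2 G (u s) y" for s y
  proof -
    have "carre_du_champ G (u s) (\<lambda>y. - laplacian G (u s) y) y
        = - carre_du_champ G (u s) (laplacian G (u s)) y"
      unfolding carre_du_champ_def mult_minus_right[symmetric] sum_negf[symmetric]
      by (simp add: algebra_simps)
    then show ?thesis by (simp add: carre_du_champ2_def)
  qed
  have \<Phi>': "(\<Phi> has_real_derivative heat s (\<lambda>y. 2 * carre_du_champ2 G (u s) y) x) (at s)" for s
    using has_derivative_heat_time_dependent[OF x, of "\<lambda>s. carre_du_champ G (u s) (u s)"
        "\<lambda>y. 2 * carre_du_champ G (u s) (\<lambda>y. - laplacian G (u s) y) y" s,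
        OF has_derivative_carre_du_champ[OF _ u']]
    unfolding \<Phi>_def gamma2 by simp
  have ge: "- 2 * k * \<Phi> s \<le> heat s (\<lambda>y. 2 * carre_du_champ2 G (u s) y) x" if "0 \<le> s" for s
  proof -
    have "- 2 * k * \<Phi> s = heat s (\<lambda>y. - 2 * k * carre_du_champ G (u s) (u s) y) x"
      unfolding \<Phi>_def by (rule heat_cmult[symmetric])
    also have "\<dots> \<le> heat s (\<lambda>y. 2 * carre_du_champ2 G (u s) y) x"
      using ric x that by (intro heat_mono) (auto simp: ric_ge_def)
    finally show ?thesis .
  qed
  \<comment> \<open>Gronwall's argument with the integrating factor
    \<open>exp (2 * k * s)\<close>.\<close>
  have "exp (2 * k * 0) * \<Phi> 0 \<le> exp (2 * k * s) * \<Phi> s"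
  proof (rule DERIV_nonneg_imp_nondecreasing[OF s])
    fix r assume r: "0 \<le> r" "r \<le> s"
    have "((\<lambda>s. exp (2 * k * s) * \<Phi> s) has_real_derivative
        exp (2 * k * r) * (2 * k * \<Phi> r + heat r (\<lambda>y. 2 * carre_du_champ2 G (u r) y) x)) (at r)"
      by (rule derivative_eq_intros refl \<Phi>')+ (simp add: algebra_simps)
    moreover have "0 \<le> exp (2 * k * r) * (2 * k * \<Phi> r + heat r (\<lambda>y. 2 * carre_du_champ2 G (u r) y) x)"
      using ge[OF r(1)] by simp
    ultimately show "\<exists>y. ((\<lambda>s. exp (2 * k * s) * \<Phi> s) has_real_derivative y) (at r) \<and> 0 \<le> y"
      by blast
  qed
  moreover have "\<Phi> 0 = carre_du_champ G (heat t f) (heat t f) x"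
    unfolding \<Phi>_def u_def using x by (simp add: heat_0)
  ultimately have "carre_du_champ G (heat t f) (heat t f) x \<le> exp (2 * k * s) * \<Phi> s"
    by simp
  then have "exp (- 2 * k * s) * carre_du_champ G (heat t f) (heat t f) x
      \<le> exp (- 2 * k * s) * (exp (2 * k * s) * \<Phi> s)"
    by (intro mult_left_mono) auto
  also have "\<dots> = \<Phi> s"
    by (simp add: mult.assoc[symmetric] exp_add[symmetric])
  finally show ?thesis
    unfolding \<Phi>_def u_def .
qed

text \<open>The derivative of
  \<open>\<Psi> s = P\<^sub>s ((P\<^sub>t\<^sub>-\<^sub>s f)\<^sup>2)\<close> is
  \<open>2 P\<^sub>s (\<Gamma> (P\<^sub>t\<^sub>-\<^sub>s f))\<close>, which is at least
  \<open>2 exp (- 2 * k * s) \<Gamma> (P\<^sub>t f)\<close>. The claim is this bound integrated over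
  \<open>[0,t]\<close>.\<close>

lemma reverse_poincare:
  assumes ric: "ric_ge G (- k)" and k: "0 < k" and x: "x \<in> verts G" and t: "0 \<le> t"
  shows "(1 - exp (- 2 * k * t)) / k * carre_du_champ G (heat t f) (heat t f) x
       \<le> heat t (\<lambda>y. (f y)\<^sup>2) x - (heat t f x)\<^sup>2"
proof -
  define u where "u = (\<lambda>s. heat (t - s) f)"
  define \<Psi> where "\<Psi> = (\<lambda>s. heat s (\<lambda>y. (u s y)\<^sup>2) x)"
  define g where "g = carre_du_champ G (heat t f) (heat t f) x"
  have u': "((\<lambda>s. u s y) has_real_derivative - laplacian G (u s) y) (at s)"
    if "y \<in> verts G" for y s
    unfolding u_def by (rule has_derivative_heat_reversed[OF that])
  have usq': "((\<lambda>s. (u s y)\<^sup>2) has_real_derivative - 2 * u s y * laplacian G (u s) y) (at s)"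
    if "y \<in> verts G" for y s
    by (rule derivative_eq_intros refl u'[OF that])+ simp
  have \<Psi>': "(\<Psi> has_real_derivative 2 * heat s (carre_du_champ G (u s) (u s)) x) (at s)" for s
    using has_derivative_heat_time_dependent[OF x, of "\<lambda>s y. (u s y)\<^sup>2", OF usq']
    unfolding \<Psi>_def by (simp add: laplacian_square heat_cmult)
  \<comment> \<open>The added term is an antiderivative of
    \<open>- 2 * exp (- 2 * k * s) * g\<close>, so monotonicity of the sum replaces
    integration.\<close>
  have "\<Psi> 0 + exp (- 2 * k * 0) / k * g \<le> \<Psi> t + exp (- 2 * k * t) / k * g"
  proof (rule DERIV_nonneg_imp_nondecreasing[OF t])
    fix r assume r: "0 \<le> r" "r \<le> t"
    have "((\<lambda>s. \<Psi> s + exp (- 2 * k * s) / k * g) has_real_derivative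
        2 * heat r (carre_du_champ G (u r) (u r)) x - 2 * (exp (- 2 * k * r) * g)) (at r)"
    proof -
      have "((\<lambda>s. exp (- 2 * k * s)) has_real_derivative - 2 * k * exp (- 2 * k * r)) (at r)"
        by (auto intro!: derivative_eq_intros)
      from DERIV_add[OF \<Psi>' DERIV_cmult_right[OF DERIV_cdivide[OF this, of k], of g]] show ?thesis
        using k by (simp add: mult.assoc)
    qed
    moreover have "0 \<le> 2 * heat r (carre_du_champ G (u r) (u r)) x - 2 * (exp (- 2 * k * r) * g)"
      using heat_carre_du_champ_lower_bound[OF ric x r(1), of t f] by (simp add: u_def g_def)
    ultimately show "\<exists>y. ((\<lambda>s. \<Psi> s + exp (- 2 * k * s) / k * g) has_real_derivative y) (at r) \<and> 0 \<le> y"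
      by blast
  qed
  moreover have "\<Psi> 0 = (heat t f x)\<^sup>2"
    unfolding \<Psi>_def u_def using x by (simp add: heat_0)
  moreover have "\<Psi> t = heat t (\<lambda>y. (f y)\<^sup>2) x"
    unfolding \<Psi>_def u_def heat_def[of t "\<lambda>y. _ y ^ 2"] by (simp add: heat_0)
  ultimately show ?thesis
    by (simp add: g_def diff_divide_distrib left_diff_distrib)
qed

lemma square_diff_le_carre_du_champ:
  assumes "y \<in> neighbors G x"
  shows "(f x - f y)\<^sup>2 \<le> 2 * carre_du_champ G f f x"
  using member_le_sum[of y "neighbors G x" "\<lambda>y. (f x - f y) * (f x - f y)"] assms
  by (simp add: carre_du_champ_def power2_eq_square)


text \<open>An indicator equals its square, so the variance in the reverse Poincare inequality is
  \<open>h x - (h x)\<^sup>2\<close>, at most \<open>1/4\<close>.\<close>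

lemma heat_indicator_diff_le:
  assumes ric: "ric_ge G (- k)" and k: "0 < k"
    and x: "x \<in> verts G" and y: "y \<in> neighbors G x"
    and t: "0 < t" "t \<le> 1 / (2 * k)"
  shows "heat t (indicator A) x - heat t (indicator A) y \<le> 1 / (2 * sqrt (63 / 100 * t))"
proof -
  define h where "h = heat t (indicator A)"
  define g where "g = carre_du_champ G h h x"
  have "(\<lambda>y. (indicator A y :: real)\<^sup>2) = indicator A"
    by (auto simp: indicator_def)
  then have "heat t (\<lambda>y. (indicator A y)\<^sup>2) x = h x"
    by (simp add: h_def)
  moreover have "(1 - exp (- (2 * k * t))) / k * g \<le> heat t (\<lambda>y. (indicator A y)\<^sup>2) x - (h x)\<^sup>2"
    using reverse_poincare[OF ric k x, of t "indicator A"] t by (simp add: g_def h_def)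
  moreover have "h x - (h x)\<^sup>2 \<le> 1 / 4"
    using zero_le_power2[of "h x - 1 / 2"] by (simp add: power2_eq_square algebra_simps)
  \<comment> \<open>The hypothesis on \<open>t\<close> says \<open>2 * k * t \<le> 1\<close>; the
    linear lower bound then cancels the division by \<open>k\<close>.\<close>
  moreover have "63 / 100 * (2 * t) * g \<le> (1 - exp (- (2 * k * t))) / k * g"
    using one_minus_exp_ge[of "2 * k * t"] k t
    by (intro mult_right_mono) (auto simp: field_simps g_def carre_du_champ_nonneg)
  ultimately have "63 / 100 * (2 * t) * g \<le> 1 / 4"
    by linarith
  then have "2 * g \<le> (1 / (2 * sqrt (63 / 100 * t)))\<^sup>2"
    using t by (simp add: power_divide power_mult_distrib field_simps)
  then have "(h x - h y)\<^sup>2 \<le> (1 / (2 * sqrt (63 / 100 * t)))\<^sup>2"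
    using square_diff_le_carre_du_champ[OF y, of h] by (simp add: g_def)
  then show ?thesis
    unfolding h_def[symmetric] by (rule power2_le_imp_le) (use t in simp)
qed

subsection \<open>Heat flow through the boundary\<close>

text \<open>Exactly one endpoint of a boundary edge lies in \<open>A\<close>, so forgetting the
  orientation is injective on pairs leading out of \<open>A\<close>.\<close>

lemma card_edge_boundary:
  assumes "A \<subseteq> verts G"
  shows "card (edge_boundary G A) = (\<Sum>x\<in>A. card (neighbors G x - A))"
proof -
  have fin: "finite A" using assms finite_verts finite_subset by blast
  have "edge_boundary G A = (\<lambda>(u, v). {u, v}) ` (SIGMA x:A. neighbors G x - A)"
    using neighbors_subset by (auto simp: edge_boundary_def neighbors_def image_iff)
  moreover have "inj_on (\<lambda>(u, v). {u, v}) (SIGMA x:A. neighbors G x - A)"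
    by (auto simp: inj_on_def doubleton_eq_iff)
  ultimately show ?thesis
    using fin by (simp add: card_image card_SigmaI)
qed

text \<open>Differences along edges inside \<open>A\<close> are antisymmetric and cancel; only the
  flux through the boundary remains.\<close>

lemma sum_laplacian_on_subset:
  assumes "A \<subseteq> verts G"
  shows "(\<Sum>x\<in>A. laplacian G f x) = (\<Sum>x\<in>A. \<Sum>y\<in>neighbors G x - A. f y - f x)"
proof -
  have fin: "finite A" using assms finite_verts finite_subset by blast
  have split: "laplacian G f x = (\<Sum>y\<in>neighbors G x \<inter> A. f y - f x) + (\<Sum>y\<in>neighbors G x - A. f y - f x)" for x
    unfolding laplacian_def by (rule sum.Int_Diff) simp
  let ?F = "\<lambda>x y. if y \<in> neighbors G x then f y - f x else 0"
  have eq: "(\<Sum>x\<in>A. \<Sum>y\<in>neighbors G x \<inter> A. f y - f x) = (\<Sum>x\<in>A. \<Sum>y\<in>A. ?F x y)"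
    using fin by (intro sum.cong sum.mono_neutral_cong_left) auto
  also have "\<dots> = (\<Sum>x\<in>A. \<Sum>y\<in>A. ?F y x)"
    by (rule sum.swap)
  also have "\<dots> = - (\<Sum>x\<in>A. \<Sum>y\<in>A. ?F x y)"
    unfolding sum_negf[symmetric] by (intro sum.cong) (auto simp: neighbors_sym)
  finally have "(\<Sum>x\<in>A. \<Sum>y\<in>neighbors G x \<inter> A. f y - f x) = 0"
    using eq by linarith
  then show ?thesis
    by (simp add: split sum.distrib)
qed


text \<open>The rate of loss is the flux through the boundary, at most
  \<open>1 / (2 * sqrt (63 / 100 * s))\<close> per edge. This is integrable at \<open>0\<close>
  although it blows up there.\<close>

lemma heat_content_loss_le:
  assumes ric: "ric_ge G (- k)" and k: "0 < k" and A: "A \<subseteq> verts G"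
    and t: "0 \<le> t" "t \<le> 1 / (2 * k)"
  shows "real (card A) - (\<Sum>x\<in>A. heat t (indicator A) x)
       \<le> real (card (edge_boundary G A)) * sqrt t / sqrt (63 / 100)"
proof -
  define B where "B = real (card (edge_boundary G A))"
  define h where "h = (\<lambda>s. heat s (indicator A :: 'a \<Rightarrow> real))"
  define F where "F = (\<lambda>s. (\<Sum>x\<in>A. h s x) + B * sqrt s / sqrt (63 / 100))"
  have h': "((\<lambda>s. \<Sum>x\<in>A. h s x) has_real_derivative (\<Sum>x\<in>A. laplacian G (h s) x)) (at s)" for s
    unfolding h_def using A by (intro DERIV_sum has_derivative_heat) auto
  \<comment> \<open>\<open>sqrt\<close> is not differentiable at \<open>0\<close>, so the derivative
    is taken only on the open interval and \<open>F\<close> is shown continuous on the closed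
    one.\<close>
  have "F 0 \<le> F t"
  proof (rule DERIV_nonneg_imp_increasing_open[OF t(1)])
    fix s assume s: "0 < s" "s < t"
    let ?b = "1 / (2 * sqrt (63 / 100 * s))"
    have "(F has_real_derivative (\<Sum>x\<in>A. laplacian G (h s) x) + B * ?b) (at s)"
    proof -
      have "(F has_real_derivative
          (\<Sum>x\<in>A. laplacian G (h s) x) + B * (inverse (sqrt s) / 2) / sqrt (63 / 100)) (at s)"
        unfolding F_def by (intro DERIV_add h' DERIV_cdivide DERIV_cmult DERIV_real_sqrt s(1))
      also have "B * (inverse (sqrt s) / 2) / sqrt (63 / 100) = B * ?b"
        by (simp add: inverse_eq_divide mult.commute flip: real_sqrt_mult)
      finally show ?thesis .
    qed
    moreover have "- (B * ?b) \<le> (\<Sum>x\<in>A. laplacian G (h s) x)"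
    proof -
      have "- ?b \<le> h s y - h s x" if "x \<in> A" "y \<in> neighbors G x" for x y
        using heat_indicator_diff_le[OF ric k _ that(2) s(1), of A] that A s t by (auto simp: h_def)
      then have "(\<Sum>x\<in>A. \<Sum>y\<in>neighbors G x - A. - ?b) \<le> (\<Sum>x\<in>A. \<Sum>y\<in>neighbors G x - A. h s y - h s x)"
        by (intro sum_mono) auto
      moreover have "(\<Sum>x\<in>A. \<Sum>y\<in>neighbors G x - A. - ?b) = - (B * ?b)"
        by (simp only: sum_constant B_def card_edge_boundary[OF A] of_nat_sum sum_distrib_right
            mult_minus_right sum_negf)
      ultimately show ?thesis
        by (simp only: sum_laplacian_on_subset[OF A])
    qed
    ultimately show "\<exists>y. (F has_real_derivative y) (at s) \<and> 0 \<le> y"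
      by force
  next
    have "continuous_on {0..t} (\<lambda>s. \<Sum>x\<in>A. h s x)"
      by (rule DERIV_continuous_on) (rule has_field_derivative_at_within[OF h'])
    then show "continuous_on {0..t} F"
      unfolding F_def by (rule continuous_on_add) (auto intro!: continuous_intros)
  qed
  moreover have "(\<Sum>x\<in>A. h 0 x) = real (card A)"
    using A by (simp add: h_def heat_0 subset_iff)
  ultimately show ?thesis
    by (simp add: F_def B_def h_def)
qed


subsection \<open>The spectral gap\<close>

text \<open>A vanishing sum of nonnegative terms forces \<open>f\<close> to agree across every edge,
  and connectedness propagates this along paths.\<close>

lemma constant_if_carre_du_champ_zero:
  assumes conn: "Digraph_Component.connected G"
    and zero: "(\<Sum>x\<in>verts G. carre_du_champ G f f x) = 0"
    and "x \<in> verts G" "y \<in> verts G"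
  shows "f x = f y"
proof -
  have "x \<rightarrow>\<^sup>*\<^bsub>G\<^esub> y"
    using symmetric_connected_imp_strongly_connected[OF sym_arcs conn] assms(3,4) by blast
  then show ?thesis
  proof (induction rule: reachable_induct)
    case (step u v)
    have "u \<in> verts G" "v \<in> neighbors G u"
      using step by (auto simp: neighbors_def elim: reachable_in_vertsE)
    moreover have "carre_du_champ G f f u = 0"
      using zero \<open>u \<in> verts G\<close> by (simp add: sum_nonneg_eq_0_iff carre_du_champ_nonneg)
    ultimately show ?case
      using square_diff_le_carre_du_champ[of v u f] step by simp
  qed simp
qed

text \<open>The energy is continuous and the normalised mean-zero functions form a compact set once
  irrelevant values are fixed.\<close>

lemma rayleigh_minimizer_exists:
  fixes g :: "'a \<Rightarrow> real"
  assumes g: "(\<Sum>x\<in>verts G. g x) = 0" "(\<Sum>x\<in>verts G. (g x)\<^sup>2) = 1"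
  obtains f where "(\<Sum>x\<in>verts G. f x) = 0" "(\<Sum>x\<in>verts G. (f x)\<^sup>2) = 1"
    "\<And>h. (\<Sum>x\<in>verts G. h x) = 0 \<Longrightarrow> (\<Sum>x\<in>verts G. (h x)\<^sup>2) = 1 \<Longrightarrow>
       (\<Sum>x\<in>verts G. carre_du_champ G f f x) \<le> (\<Sum>x\<in>verts G. carre_du_champ G h h x)"
proof -
  \<comment> \<open>Functions are total on a possibly infinite type, so values off
    \<open>verts G\<close> are pinned to \<open>0\<close>. On \<open>verts G\<close> the
    normalisation forces values into \<open>[-1,1]\<close>, and a product of compact sets is
    compact.\<close>
  define C :: "('a \<Rightarrow> real) set" where
    "C = PiE UNIV (\<lambda>x. if x \<in> verts G then {-1..1} else {0})"
  define T where "T = C \<inter> {f. (\<Sum>x\<in>verts G. f x) = 0} \<inter> {f. (\<Sum>x\<in>verts G. (f x)\<^sup>2) = 1}"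
  define E where "E = (\<lambda>f. \<Sum>x\<in>verts G. carre_du_champ G f f x)"
  have "compactin (product_topology (\<lambda>i. euclidean) UNIV) C"
    unfolding C_def compactin_PiE by auto
  then have "compact C"
    by (simp add: euclidean_product_topology)
  then have "compact T"
    unfolding T_def
    by (intro compact_Int_closed closed_Collect_eq continuous_intros continuous_on_product_coordinates)
  have restrict: "(\<lambda>x. if x \<in> verts G then h x else 0) \<in> T
      \<and> E (\<lambda>x. if x \<in> verts G then h x else 0) = E h"
    if h: "(\<Sum>x\<in>verts G. h x) = 0" "(\<Sum>x\<in>verts G. (h x)\<^sup>2) = 1" for h
  proof
    have "h x \<in> {-1..1}" if "x \<in> verts G" for x
    proof -
      have "(h x)\<^sup>2 \<le> 1"
        using member_le_sum[of x "verts G" "\<lambda>x. (h x)\<^sup>2"] that h by simp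
      then show ?thesis by (simp add: abs_square_le_1 abs_le_iff minus_le_iff)
    qed
    then show "(\<lambda>x. if x \<in> verts G then h x else 0) \<in> T"
      using h by (auto simp: T_def C_def)
    show "E (\<lambda>x. if x \<in> verts G then h x else 0) = E h"
      unfolding E_def carre_du_champ_def using neighbors_subset
      by (intro sum.cong arg_cong2[where f = "(*)"] refl) auto
  qed
  have "continuous_on UNIV E"
    unfolding E_def carre_du_champ_def
    by (intro continuous_intros continuous_on_product_coordinates)
  then have "continuous_on T E"
    using continuous_on_subset by blast
  moreover have "T \<noteq> {}"
    using restrict[OF g] by blast
  ultimately obtain f where f: "f \<in> T" "\<And>h. h \<in> T \<Longrightarrow> E f \<le> E h"
    using continuous_attains_inf[OF \<open>compact T\<close>] by blast
  show ?thesis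
  proof (rule that)
    fix h :: "'a \<Rightarrow> real"
    assume "(\<Sum>x\<in>verts G. h x) = 0" "(\<Sum>x\<in>verts G. (h x)\<^sup>2) = 1"
    from restrict[OF this] f(2) show
      "(\<Sum>x\<in>verts G. carre_du_champ G f f x) \<le> (\<Sum>x\<in>verts G. carre_du_champ G h h x)"
      unfolding E_def by metis
  qed (use f(1) in \<open>auto simp: T_def\<close>)
qed

lemma carre_du_champ_cmult:
  "carre_du_champ G (\<lambda>x. a * f x) (\<lambda>x. a * f x) x = a\<^sup>2 * carre_du_champ G f f x"
  unfolding carre_du_champ_def sum_distrib_left
  by (intro sum.cong) (auto simp: power2_eq_square algebra_simps)

lemma carre_du_champ_add_cmult:
  "carre_du_champ G (\<lambda>x. f x + e * g x) (\<lambda>x. f x + e * g x) x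
     = carre_du_champ G f f x + 2 * e * carre_du_champ G f g x + e\<^sup>2 * carre_du_champ G g g x"
  unfolding carre_du_champ_def sum_distrib_left sum.distrib[symmetric]
  by (intro sum.cong) (auto simp: power2_eq_square algebra_simps)

text \<open>A minimiser of the Rayleigh quotient among mean-zero functions is an eigenfunction. Its
  eigenvalue \<open>m\<close> is nonzero by connectedness, hence at least \<open>l\<close>.\<close>

theorem poincare_inequality:
  assumes conn: "Digraph_Component.connected G" and l: "min_nonzero_eigenvalue G l"
    and g0: "(\<Sum>x\<in>verts G. g x) = 0"
  shows "l * (\<Sum>x\<in>verts G. (g x)\<^sup>2) \<le> (\<Sum>x\<in>verts G. carre_du_champ G g g x)"
proof (cases "(\<Sum>x\<in>verts G. (g x)\<^sup>2) = 0")
  case True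
  then show ?thesis by (simp add: sum_nonneg carre_du_champ_nonneg)
next
  case False
  define E where "E = (\<lambda>f. \<Sum>x\<in>verts G. carre_du_champ G f f x)"
  define N where "N = (\<lambda>f :: 'a \<Rightarrow> real. \<Sum>x\<in>verts G. (f x)\<^sup>2)"
  have E_cmult: "E (\<lambda>x. a * f x) = a\<^sup>2 * E f" for a f
    by (simp add: E_def carre_du_champ_cmult sum_distrib_left)
  have N_cmult: "N (\<lambda>x. a * f x) = a\<^sup>2 * N f" for a f
    by (simp add: N_def power_mult_distrib sum_distrib_left)
  have N_nonneg: "0 \<le> N f" for f
    by (simp add: N_def sum_nonneg)
  have normalize: "(\<Sum>x\<in>verts G. 1 / sqrt (N h) * h x) = 0 \<and> N (\<lambda>x. 1 / sqrt (N h) * h x) = 1"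
    if "(\<Sum>x\<in>verts G. h x) = 0" "N h \<noteq> 0" for h
    using that N_nonneg[of h]
    by (simp only: N_cmult sum_distrib_left[symmetric]) (simp add: power_divide)
  obtain f where f: "(\<Sum>x\<in>verts G. f x) = 0" "N f = 1"
    "\<And>h. (\<Sum>x\<in>verts G. h x) = 0 \<Longrightarrow> N h = 1 \<Longrightarrow> E f \<le> E h"
    using rayleigh_minimizer_exists[of "\<lambda>x. 1 / sqrt (N g) * g x"] normalize[OF g0] False
    unfolding N_def E_def by blast
  define m where "m = E f"
  have min: "m * N h \<le> E h" if h: "(\<Sum>x\<in>verts G. h x) = 0" for h
  proof (cases "N h = 0")
    case True
    then show ?thesis by (simp add: E_def sum_nonneg carre_du_champ_nonneg)
  next
    case False
    have "m \<le> E (\<lambda>x. 1 / sqrt (N h) * h x)"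
      unfolding m_def using f(3) normalize[OF h False] by blast
    also have "\<dots> = E h / N h"
      using N_nonneg[of h] by (simp only: E_cmult) (simp add: power_divide)
    finally show ?thesis
      using False N_nonneg[of h] by (simp add: field_simps)
  qed
  \<comment> \<open>The residual of the eigenvalue equation also has mean zero, so \<open>f\<close>
    may be varied in its direction. The first variation of \<open>E - m * N\<close> is then
    \<open>2 * N r\<close>, which forces \<open>r\<close> to vanish.\<close>
  define r where "r = (\<lambda>x. - laplacian G f x - m * f x)"
  have r0: "(\<Sum>x\<in>verts G. r x) = 0"
    by (simp add: r_def sum_subtractf sum_negf sum_laplacian f(1) flip: sum_distrib_left)
  have "0 \<le> 2 * e * N r + e\<^sup>2 * (E r - m * N r)" for e
  proof -
    have "(\<Sum>x\<in>verts G. f x + e * r x) = 0"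
      by (simp add: sum.distrib f(1) r0 flip: sum_distrib_left)
    from min[OF this] have "m * N (\<lambda>x. f x + e * r x) \<le> E (\<lambda>x. f x + e * r x)" .
    moreover have "E (\<lambda>x. f x + e * r x)
        = E f + 2 * e * (\<Sum>x\<in>verts G. carre_du_champ G f r x) + e\<^sup>2 * E r"
      by (simp add: E_def carre_du_champ_add_cmult sum.distrib sum_distrib_left)
    moreover have "N (\<lambda>x. f x + e * r x) = N f + 2 * e * (\<Sum>x\<in>verts G. r x * f x) + e\<^sup>2 * N r"
      unfolding N_def sum_distrib_left sum.distrib[symmetric]
      by (intro sum.cong) (auto simp: power2_eq_square algebra_simps)
    moreover have "(\<Sum>x\<in>verts G. carre_du_champ G f r x) = N r + m * (\<Sum>x\<in>verts G. r x * f x)"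
    proof -
      have "(\<Sum>x\<in>verts G. carre_du_champ G f r x) = (\<Sum>x\<in>verts G. r x * (- laplacian G f x))"
        using sum_mult_laplacian[of r f] by (simp add: sum_negf)
      also have "\<dots> = N r + m * (\<Sum>x\<in>verts G. r x * f x)"
        unfolding N_def sum_distrib_left sum.distrib[symmetric]
        by (intro sum.cong) (auto simp: r_def power2_eq_square algebra_simps)
      finally show ?thesis .
    qed
    ultimately show ?thesis
      using f(2) by (simp add: m_def algebra_simps)
  qed
  then have "N r = 0"
    by (rule linear_coeff_zero_of_quadratic_nonneg)
  then have "\<forall>x\<in>verts G. - laplacian G f x = m * f x"
    by (simp add: N_def sum_nonneg_eq_0_iff r_def)
  moreover have "\<exists>x\<in>verts G. f x \<noteq> 0"
    using f(2) unfolding N_def by (metis (no_types, lifting) sum.neutral zero_neq_one zero_power2)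
  ultimately have "neg_laplacian_eigenvalue G m"
    unfolding neg_laplacian_eigenvalue_def by blast
  \<comment> \<open>Zero energy would make \<open>f\<close> constant, and a constant with mean zero
    vanishes.\<close>
  moreover have "m \<noteq> 0"
  proof
    assume "m = 0"
    from \<open>\<exists>x\<in>verts G. f x \<noteq> 0\<close> obtain x where x: "x \<in> verts G" "f x \<noteq> 0" by blast
    have "f y = f x" if "y \<in> verts G" for y
      using constant_if_carre_du_champ_zero[OF conn _ that x(1), of f] \<open>m = 0\<close>
      by (simp add: m_def E_def)
    then have "(\<Sum>y\<in>verts G. f y) = real (card (verts G)) * f x"
      by simp
    with f(1) x show False by auto
  qed
  ultimately have "l \<le> m"
    using l unfolding min_nonzero_eigenvalue_def by blast
  then have "l * N g \<le> m * N g"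
    using N_nonneg by (intro mult_right_mono)
  also have "\<dots> \<le> E g"
    by (rule min[OF g0])
  finally show ?thesis
    unfolding E_def N_def .
qed

text \<open>The squared norm decreases at twice the Dirichlet energy. The flow keeps the mean zero,
  so the Poincare inequality applies at all times and Gronwall's argument gives the decay.\<close>

lemma heat_l2_decay:
  assumes conn: "Digraph_Component.connected G" and l: "min_nonzero_eigenvalue G l"
    and f0: "(\<Sum>x\<in>verts G. f x) = 0" and t: "0 \<le> t"
  shows "(\<Sum>x\<in>verts G. (heat t f x)\<^sup>2) \<le> exp (- 2 * l * t) * (\<Sum>x\<in>verts G. (f x)\<^sup>2)"
proof -
  define N where "N = (\<lambda>s. \<Sum>x\<in>verts G. (heat s f x)\<^sup>2)"
  have N': "(N has_real_derivative - 2 * (\<Sum>x\<in>verts G. carre_du_champ G (heat s f) (heat s f) x)) (at s)" for s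
  proof -
    have "((\<lambda>s. (heat s f x)\<^sup>2) has_real_derivative 2 * (heat s f x * laplacian G (heat s f) x)) (at s)"
      if "x \<in> verts G" for x
      by (rule derivative_eq_intros refl has_derivative_heat[OF that])+ simp
    then have "(N has_real_derivative (\<Sum>x\<in>verts G. 2 * (heat s f x * laplacian G (heat s f) x))) (at s)"
      unfolding N_def by (intro DERIV_sum)
    then show ?thesis
      by (simp add: sum_mult_laplacian flip: sum_distrib_left)
  qed
  have "exp (2 * l * t) * N t \<le> exp (2 * l * 0) * N 0"
  proof (rule DERIV_nonpos_imp_nonincreasing[OF t])
    fix s
    let ?E = "\<Sum>x\<in>verts G. carre_du_champ G (heat s f) (heat s f) x"
    have "((\<lambda>s. exp (2 * l * s) * N s) has_real_derivative exp (2 * l * s) * (2 * (l * N s - ?E))) (at s)"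
      by (rule derivative_eq_intros refl N')+ (simp add: algebra_simps)
    moreover have "l * N s \<le> ?E"
      unfolding N_def using f0 by (intro poincare_inequality[OF conn l]) (simp add: sum_heat)
    then have "exp (2 * l * s) * (2 * (l * N s - ?E)) \<le> 0"
      by (intro mult_nonneg_nonpos) auto
    ultimately show "\<exists>y. ((\<lambda>s. exp (2 * l * s) * N s) has_real_derivative y) (at s) \<and> y \<le> 0"
      by blast
  qed
  moreover have "N 0 = (\<Sum>x\<in>verts G. (f x)\<^sup>2)"
    by (simp add: N_def heat_0)
  ultimately show ?thesis
    by (simp add: N_def exp_minus field_simps)
qed

text \<open>Split the indicator of \<open>A\<close> into its mean \<open>a\<close> and a mean-zero
  part \<open>g\<close>. The mean is preserved by the flow, while
  \<open>\<langle>g, P\<^sub>t g\<rangle>\<close> is at most \<open>exp (- (l * t))\<close> times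
  the squared norm of \<open>g\<close> by Cauchy-Schwarz and the decay.\<close>

lemma heat_content_le:
  assumes conn: "Digraph_Component.connected G" and l: "min_nonzero_eigenvalue G l"
    and A: "A \<subseteq> verts G" and t: "0 \<le> t"
  shows "(1 - exp (- (l * t))) * (real (card A) * (1 - real (card A) / real (card (verts G))))
       \<le> real (card A) - (\<Sum>x\<in>A. heat t (indicator A) x)"
proof (cases "verts G = {}")
  \<comment> \<open>The density divides by zero here, but \<open>A\<close> is then empty and both
    sides vanish.\<close>
  case True
  then show ?thesis using A by simp
next
  case False
  define n where "n = real (card (verts G))"
  define a where "a = real (card A) / n"
  define g where "g = (\<lambda>x. indicator A x - a)"
  have n: "n > 0" using False by (simp add: n_def card_gt_0_iff)
  have sumA: "(\<Sum>x\<in>verts G. indicator A x * F x) = (\<Sum>x\<in>A. F x)" for F :: "'a \<Rightarrow> real"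
    using A by (intro sum.mono_neutral_cong_right) auto
  have "a * n = real (card A)"
    using n by (simp add: a_def)
  have g0: "(\<Sum>x\<in>verts G. g x) = 0"
    using sumA[of "\<lambda>_. 1"] \<open>a * n = _\<close> by (simp add: g_def sum_subtractf n_def mult.commute)
  have heat_g: "heat t g x = heat t (indicator A) x - a" if "x \<in> verts G" for x
    using heat_const[OF that, of t a]
    by (simp add: heat_def g_def right_diff_distrib sum_subtractf)
  have gg: "(\<Sum>x\<in>verts G. (g x)\<^sup>2) = real (card A) * (1 - a)"
  proof -
    have "(\<Sum>x\<in>verts G. (g x)\<^sup>2) = (\<Sum>x\<in>verts G. indicator A x * g x) - a * (\<Sum>x\<in>verts G. g x)"
      unfolding sum_distrib_left sum_subtractf[symmetric]
      by (intro sum.cong) (auto simp: g_def power2_eq_square algebra_simps)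
    also have "\<dots> = real (card A) * (1 - a)"
      unfolding sumA g0 by (simp add: g_def)
    finally show ?thesis .
  qed
  have "(\<Sum>x\<in>verts G. g x * heat t g x)\<^sup>2
      \<le> (\<Sum>x\<in>verts G. (g x)\<^sup>2) * (\<Sum>x\<in>verts G. (heat t g x)\<^sup>2)"
    by (rule Cauchy_Schwarz_ineq_sum)
  also have "\<dots> \<le> (\<Sum>x\<in>verts G. (g x)\<^sup>2) * (exp (- 2 * l * t) * (\<Sum>x\<in>verts G. (g x)\<^sup>2))"
    by (intro mult_left_mono heat_l2_decay[OF conn l g0 t] sum_nonneg) simp
  also have "\<dots> = (exp (- (l * t)) * (\<Sum>x\<in>verts G. (g x)\<^sup>2))\<^sup>2"
    by (simp add: power2_eq_square mult_ac exp_add[symmetric])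
  finally have "(\<Sum>x\<in>verts G. g x * heat t g x) \<le> exp (- (l * t)) * (\<Sum>x\<in>verts G. (g x)\<^sup>2)"
    by (rule power2_le_imp_le) (simp add: sum_nonneg)
  moreover have "(\<Sum>x\<in>verts G. g x * heat t g x) = (\<Sum>x\<in>A. heat t (indicator A) x) - a * real (card A)"
  proof -
    have "(\<Sum>x\<in>verts G. g x * heat t g x)
        = (\<Sum>x\<in>verts G. indicator A x * heat t g x) - a * (\<Sum>x\<in>verts G. heat t g x)"
      unfolding sum_distrib_left sum_subtractf[symmetric]
      by (intro sum.cong) (auto simp: g_def algebra_simps)
    also have "(\<Sum>x\<in>verts G. heat t g x) = 0"
      using g0 by (simp add: sum_heat)
    also have "(\<Sum>x\<in>verts G. indicator A x * heat t g x) = (\<Sum>x\<in>A. heat t (indicator A) x - a)"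
      unfolding sumA using A by (intro sum.cong) (auto simp: heat_g)
    finally show ?thesis
      by (simp add: sum_subtractf mult.commute)
  qed
  ultimately show ?thesis
    unfolding gg n_def[symmetric] a_def[symmetric] by (simp add: algebra_simps)
qed

section \<open>Comparing the two bounds on the loss of heat content\<close>

text \<open>At \<open>t = 1 / (2 * k)\<close> the hypothesis \<open>l \<le> 2 * k\<close> gives
  \<open>l * t \<le> 1\<close>, so the spectral lower bound on the loss is linear in
  \<open>l * t\<close>, while the gradient upper bound grows like \<open>sqrt t\<close>.\<close>

theorem buser_inequality:
  assumes conn: "Digraph_Component.connected G" and l: "min_nonzero_eigenvalue G l"
    and ric: "ric_ge G (- k)" and "0 < l" "l \<le> 2 * k" and A: "A \<subseteq> verts G"
  shows "1 / 2 * (l / sqrt (2 * k)) * (real (card A) * (1 - real (card A) / real (card (verts G))))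
       \<le> real (card (edge_boundary G A))"
proof -
  define N where "N = real (card A) * (1 - real (card A) / real (card (verts G)))"
  define B where "B = real (card (edge_boundary G A))"
  define c :: real where "c = 63 / 100"
  define t where "t = 1 / (2 * k)"
  have k: "0 < k" using assms by linarith
  have t: "0 < t" "t \<le> 1 / (2 * k)" using k by (auto simp: t_def)
  have "card A \<le> card (verts G)"
    using A by (intro card_mono) auto
  then have N: "0 \<le> N"
    by (cases "card (verts G) = 0") (auto simp: N_def divide_le_eq_1 intro!: mult_nonneg_nonneg)
  \<comment> \<open>Squared, this reads \<open>c\<^sup>3 = 0.250047 \<ge> 1/4\<close>.\<close>
  have c: "1 / 2 \<le> c * sqrt c"
    by (rule power2_le_imp_le) (simp_all add: c_def power_mult_distrib power2_eq_square)
  have "c * (l * t) * N \<le> (1 - exp (- (l * t))) * N"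
    unfolding c_def using N assms k t
    by (intro mult_right_mono one_minus_exp_ge) (auto simp: t_def)
  also have "\<dots> \<le> B * sqrt t / sqrt c"
    using heat_content_le[OF conn l A, of t] heat_content_loss_le[OF ric k A _ t(2)] t
    unfolding N_def B_def c_def by simp
  finally have "c * (l * t) * N * sqrt c \<le> B * sqrt t"
    by (simp add: c_def pos_le_divide_eq)
  \<comment> \<open>Splitting \<open>t\<close> lets one factor \<open>sqrt t\<close> cancel; the
    other becomes \<open>1 / sqrt (2 * k)\<close>.\<close>
  also have "c * (l * t) * N * sqrt c = c * (l * (sqrt t * sqrt t)) * N * sqrt c"
    using t by simp
  also have "\<dots> = (c * sqrt c * (l * sqrt t) * N) * sqrt t"
    by (simp only: mult_ac)
  finally have "c * sqrt c * (l * sqrt t) * N \<le> B"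
    by (rule mult_right_le_imp_le) (use t in simp)
  moreover have "1 / 2 * (l * sqrt t) * N \<le> c * sqrt c * (l * sqrt t) * N"
    using c N t assms by (intro mult_right_mono) auto
  moreover have "sqrt t = 1 / sqrt (2 * k)"
    by (simp add: t_def real_sqrt_divide)
  ultimately show ?thesis
    unfolding N_def B_def by simp
qed

lemma ric_ge_mono: "ric_ge G K \<Longrightarrow> K' \<le> K \<Longrightarrow> ric_ge G K'"
  unfolding ric_ge_def
  by (meson carre_du_champ_nonneg mult_right_mono order_trans)

end

theorem theorem15:
  fixes G :: "('a, 'b) pre_digraph" and K l :: real and A :: "'a set"
  assumes "Digraph.graph G"
    and "Digraph_Component.connected G"
    and "\<forall>x\<in>verts G. neighbors G x \<noteq> {}"
    and "ric_ge G K"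
    and "min_nonzero_eigenvalue G l"
    and "l > 0"
    and "A \<subseteq> verts G"
  shows "ereal (real (card (edge_boundary G A))) \<ge>
    ereal (1 / 2)
    * min (ereal (sqrt l)) (if K = 0 then \<infinity> else ereal (l / sqrt (2 * \<bar>K\<bar>)))
    * ereal (real (card A) * (1 - real (card A) / real (card (verts G))))"
proof -
  interpret Digraph.graph G by fact
  \<comment> \<open>Since \<open>- k \<le> K\<close>, the curvature bound may be weakened to
    \<open>- k\<close>; the second entry keeps \<open>k\<close> positive when
    \<open>K = 0\<close>.\<close>
  define k where "k = max \<bar>K\<bar> (l / 2)"
  have "ric_ge G (- k)"
    by (rule ric_ge_mono[OF \<open>ric_ge G K\<close>]) (auto simp: k_def)
  then have "1 / 2 * (l / sqrt (2 * k)) * (real (card A) * (1 - real (card A) / real (card (verts G))))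
      \<le> real (card (edge_boundary G A))"
    using assms by (intro buser_inequality) (auto simp: k_def)
  \<comment> \<open>The entries of the minimum cross at \<open>2 * \<bar>K\<bar> = l\<close>, where
    the maximum defining \<open>k\<close> switches; \<open>K = 0\<close> falls under the first
    case.\<close>
  moreover have "min (ereal (sqrt l)) (if K = 0 then \<infinity> else ereal (l / sqrt (2 * \<bar>K\<bar>)))
      = ereal (l / sqrt (2 * k))"
  proof (cases "2 * \<bar>K\<bar> \<le> l")
    case True
    then have "l / sqrt (2 * k) = sqrt l"
      using \<open>l > 0\<close> by (simp add: k_def max_def real_div_sqrt)
    moreover have "sqrt l \<le> l / sqrt (2 * \<bar>K\<bar>)" if "K \<noteq> 0"
    proof -
      have "l / sqrt l \<le> l / sqrt (2 * \<bar>K\<bar>)"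
        using True that \<open>l > 0\<close> by (intro divide_left_mono) auto
      then show ?thesis using \<open>l > 0\<close> by (simp add: real_div_sqrt)
    qed
    ultimately show ?thesis by (simp add: min_def)
  next
    case False
    then have "K \<noteq> 0" "k = \<bar>K\<bar>"
      using \<open>l > 0\<close> by (auto simp: k_def)
    have "l / sqrt (2 * \<bar>K\<bar>) \<le> l / sqrt l"
      using False \<open>l > 0\<close> by (intro divide_left_mono) auto
    then have "l / sqrt (2 * \<bar>K\<bar>) \<le> sqrt l"
      using \<open>l > 0\<close> by (simp add: real_div_sqrt)
    then show ?thesis
      using \<open>K \<noteq> 0\<close> \<open>k = \<bar>K\<bar>\<close> by (simp add: min_def)
  qed
  ultimately show ?thesis
    by simp
qed

end
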